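(* Let $x_0\in\mathbb{R}^n$ and $\delta>0$. Suppose $F:B(x_0,\delta)\to\mathbb{R}$ is a $C^1$ function and $T\in\mathbb{R}^n$ is a non-zero vector. Assume that for all $x\in B(x_0,\delta)$, $$|\nabla F(x)\cdot T|>\frac{|T|\,|F(x_0)|}{\delta}.$$ Then $F$ has a zero inside $B(x_0,\delta)$.
   Context: $B(x_0,\delta)$ is the open Euclidean ball of center $x_0$ and radius $\delta$ in $\mathbb{R}^n$; $|\cdot|$ is the Euclidean norm. *)

theory Defs
  imports "HOL-Analysis.Analysis"
begin

text \<open>The value is unspecified where the function is not differentiable.\<close>

definition gradient :: "('a::euclidean_space \<Rightarrow> real) \<Rightarrow> 'a \<Rightarrow> 'a" where
  "gradient F x = (THE D. GDERIV F x :> D)"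

text \<open>Meant for open sets: derivatives are taken at \<open>x\<close>, not within \<open>S\<close>, so for open \<open>S\<close>
  only the values of \<open>F\<close> on \<open>S\<close> matter.\<close>

definition C1_on :: "'a::euclidean_space set \<Rightarrow> ('a \<Rightarrow> real) \<Rightarrow> bool" where
  "C1_on S F \<longleftrightarrow> (\<forall>x\<in>S. F differentiable (at x)) \<and> continuous_on S (gradient F)"

lemma gradient_eqI:
  assumes "GDERIV F x :> D"
  shows "gradient F x = D"
  unfolding gradient_def
proof (rule the_equality)
  fix D' assume "GDERIV F x :> D'"
  with assms have "(\<lambda>h. inner h D') = (\<lambda>h. inner h D)"
    unfolding gderiv_def by (metis has_derivative_unique)
  then have "inner h D' = inner h D" for h
    by (rule fun_cong)
  then have "\<forall>h. inner h D' = inner h D"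
    by (rule allI)
  then show "D' = D"
    by (rule iffD1[OF vector_eq_ldot])
qed (fact assms)

lemma differentiable_imp_GDERIV_gradient:
  fixes F :: "'a::euclidean_space \<Rightarrow> real"
  assumes "F differentiable (at x)"
  shows "GDERIV F x :> gradient F x"
proof -
  obtain F' where F': "(F has_derivative F') (at x)"
    using assms by (auto simp: differentiable_def)
  then have lin: "linear F'"
    by (rule has_derivative_linear)
  have "F' h = inner h (\<Sum>b\<in>Basis. F' b *\<^sub>R b)" for h
  proof -
    have "F' h = F' (\<Sum>b\<in>Basis. inner h b *\<^sub>R b)"
      by (simp only: euclidean_representation)
    also have "\<dots> = (\<Sum>b\<in>Basis. inner h b * F' b)"
      by (simp only: linear_sum[OF lin] linear_scale[OF lin] real_scaleR_def)
    also have "\<dots> = inner h (\<Sum>b\<in>Basis. F' b *\<^sub>R b)"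
      by (simp only: inner_sum_right inner_scaleR_right mult.commute)
    finally show ?thesis .
  qed
  then have "F' = (\<lambda>h. inner h (\<Sum>b\<in>Basis. F' b *\<^sub>R b))"
    by (rule ext)
  with F' have "GDERIV F x :> (\<Sum>b\<in>Basis. F' b *\<^sub>R b)"
    unfolding gderiv_def by (rule has_derivative_subst)
  with gradient_eqI[OF this] show ?thesis
    by (simp only:)
qed

end

theory Submission
  imports Defs
begin

text \<open>
  The zero already lies on the diameter of the ball parallel to \<open>T\<close>. The continuous function
  \<open>x \<mapsto> gradient F x \<bullet> T\<close> vanishes nowhere on the connected ball, so it has a fixed sign there.
  Hence one of the two unit vectors parallel to \<open>T\<close> is a direction in which \<open>\<bar>F\<bar>\<close> falls, as
  long as \<open>F\<close> keeps the sign of \<open>F x0\<close>, at a rate strictly above \<open>\<bar>F x0\<bar> / \<delta>\<close>. At this rate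
  the initial value \<open>\<bar>F x0\<bar>\<close> is used up strictly before the distance \<open>\<delta>\<close> has been travelled,
  and the intermediate value theorem yields a zero; this one-dimensional part is
  \<open>zero_if_fast_decrease\<close>.
\<close>

text \<open>
  The point \<open>\<delta>\<close> itself is not available, and the bound on the slope compares \<open>f\<close> only with a
  line that reaches \<open>0\<close> exactly there. But the bound is strict, so at \<open>\<delta> / 2\<close> the function is
  already below that line by some \<open>c > 0\<close>. This gap never shrinks afterwards, and it makes
  \<open>f\<close> negative as soon as the line is at height at most \<open>c\<close>.
\<close>

lemma zero_if_fast_decrease:
  fixes f f' :: "real \<Rightarrow> real"
  assumes "\<delta> > 0" and pos: "f 0 > 0"
    and der: "\<And>s. 0 \<le> s \<Longrightarrow> s < \<delta> \<Longrightarrow> (f has_real_derivative f' s) (at s)"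
    and slope: "\<And>s. 0 \<le> s \<Longrightarrow> s < \<delta> \<Longrightarrow> f' s < - (f 0 / \<delta>)"
  shows "\<exists>s. 0 < s \<and> s < \<delta> \<and> f s = 0"
proof -
  define m where "m = f 0 / \<delta>"
  have "m > 0" and f0: "f 0 = m * \<delta>"
    using \<open>\<delta> > 0\<close> pos by (simp_all add: m_def)
  have drop: "f b < f a - m * (b - a)" if "0 \<le> a" "a < b" "b < \<delta>" for a b
  proof -
    have "(f has_real_derivative f' x) (at x)" if "a \<le> x" "x \<le> b" for x
      using that \<open>0 \<le> a\<close> \<open>b < \<delta>\<close> by (intro der) linarith+
    from MVT2[OF \<open>a < b\<close> this]
    obtain z where z: "a < z" "z < b" "f b - f a = (b - a) * f' z"
      by blast
    have "(b - a) * f' z < (b - a) * - m"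
      using slope[of z] z that by (intro mult_strict_left_mono) (auto simp: m_def)
    with z show ?thesis by (simp add: mult.commute)
  qed
  define c where "c = m * (\<delta> / 2) - f (\<delta> / 2)"
  have "c > 0"
    using drop[of 0 "\<delta> / 2"] \<open>\<delta> > 0\<close> f0 by (simp add: c_def mult.commute)
  \<comment> \<open>\<open>m * r\<close> is the height of the line at \<open>\<delta> - r\<close>, and \<open>r < \<delta> / 2\<close> puts \<open>\<delta> - r\<close> beyond \<open>\<delta> / 2\<close>.\<close>
  define r where "r = min (\<delta> / 4) (c / m)"
  have "0 < r" "r < \<delta> / 2" "r \<le> c / m"
    using \<open>c > 0\<close> \<open>m > 0\<close> \<open>\<delta> > 0\<close> by (simp_all add: r_def min_less_iff_disj)
  with \<open>m > 0\<close> have r: "0 < r" "r < \<delta> / 2" "m * r \<le> c"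
    by (simp_all add: pos_le_divide_eq mult.commute)
  have "f (\<delta> - r) < f (\<delta> / 2) - m * (\<delta> - r - \<delta> / 2)"
    using r \<open>\<delta> > 0\<close> by (intro drop) auto
  also have "\<dots> = m * r - c"
    by (simp add: c_def field_simps)
  finally have neg: "f (\<delta> - r) < 0"
    using r by simp
  have "isCont f x" if "0 \<le> x" "x \<le> \<delta> - r" for x
    using that r by (intro DERIV_isCont[OF der]) auto
  then have "\<exists>s\<ge>0. s \<le> \<delta> - r \<and> f s = 0"
    using neg pos r \<open>\<delta> > 0\<close> by (intro IVT2) auto
  then obtain s where s: "0 \<le> s" "s \<le> \<delta> - r" "f s = 0"
    by blast
  then have "s \<noteq> 0"
    using pos by auto
  with s r show ?thesis
    by (intro exI[of _ s]) auto
qed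

lemma connected_nonzero_constant_sign:
  fixes g :: "'a::topological_space \<Rightarrow> real"
  assumes "connected S" "continuous_on S g" "\<And>x. x \<in> S \<Longrightarrow> g x \<noteq> 0"
  obtains e where "\<bar>e\<bar> = 1" "\<And>x. x \<in> S \<Longrightarrow> e * g x = \<bar>g x\<bar>"
proof -
  have "connected (g ` S)"
    using assms by (intro connected_continuous_image)
  then have "0 \<in> g ` S" if "x \<in> S" "y \<in> S" "g x < 0" "g y > 0" for x y
    using that connectedD_interval[of "g ` S" "g x" "g y" 0] by auto
  with assms(3) have "(\<forall>x\<in>S. g x > 0) \<or> (\<forall>x\<in>S. g x < 0)"
    by (metis imageE linorder_neqE_linordered_idom)
  then show thesis
  proof
    assume "\<forall>x\<in>S. g x > 0"
    then show thesis by (intro that[of 1]) auto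
  next
    assume "\<forall>x\<in>S. g x < 0"
    then show thesis by (intro that[of "-1"]) auto
  qed
qed

lemma DERIV_along_line:
  fixes F :: "'a::euclidean_space \<Rightarrow> real"
  assumes "F differentiable (at (x + s *\<^sub>R w))"
  shows "((\<lambda>t. F (x + t *\<^sub>R w)) has_real_derivative gradient F (x + s *\<^sub>R w) \<bullet> w) (at s)"
proof -
  have F: "(F has_derivative (\<lambda>h. h \<bullet> gradient F (x + s *\<^sub>R w))) (at (x + s *\<^sub>R w))"
    using differentiable_imp_GDERIV_gradient[OF assms] by (simp add: gderiv_def)
  have "((\<lambda>t. x + t *\<^sub>R w) has_derivative (\<lambda>t. t *\<^sub>R w)) (at s)"
    by (auto intro!: derivative_eq_intros)
  from has_derivative_compose[OF this F] show ?thesis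
    by (simp add: has_field_derivative_def inner_commute mult.commute[of _ "_ \<bullet> _"])
qed

theorem lemma2p1:
  fixes x0 T :: "real ^ 'n" and \<delta> :: real and F :: "real ^ 'n \<Rightarrow> real"
  assumes "\<delta> > 0"
    and "C1_on (ball x0 \<delta>) F"
    and "T \<noteq> 0"
    and "\<And>x. x \<in> ball x0 \<delta> \<Longrightarrow> \<bar>gradient F x \<bullet> T\<bar> > norm T * \<bar>F x0\<bar> / \<delta>"
  shows "\<exists>x\<in>ball x0 \<delta>. F x = 0"
proof (cases "F x0 = 0")
  case True
  with \<open>\<delta> > 0\<close> show ?thesis by (intro bexI[of _ x0]) auto
next
  case False
  let ?B = "ball x0 \<delta>"
  have diff: "F differentiable (at x)" if "x \<in> ?B" for x
    using assms(2) that by (simp add: C1_on_def)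
  have "continuous_on ?B (\<lambda>x. gradient F x \<bullet> T)"
    using assms(2) by (auto simp: C1_on_def intro!: continuous_intros)
  moreover have "gradient F x \<bullet> T \<noteq> 0" if "x \<in> ?B" for x
  proof -
    have "0 \<le> norm T * \<bar>F x0\<bar> / \<delta>"
      using \<open>\<delta> > 0\<close> by simp
    with assms(4)[OF that] show ?thesis by auto
  qed
  ultimately obtain e where e: "\<bar>e\<bar> = 1"
    "\<And>x. x \<in> ?B \<Longrightarrow> e * (gradient F x \<bullet> T) = \<bar>gradient F x \<bullet> T\<bar>"
    by (rule connected_nonzero_constant_sign[OF connected_ball]) auto
  define \<sigma> where "\<sigma> = sgn (F x0)"
  have \<sigma>: "\<bar>\<sigma>\<bar> = 1" "\<sigma> * \<sigma> = 1" "\<sigma> * F x0 = \<bar>F x0\<bar>"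
    using False by (auto simp: \<sigma>_def sgn_if)
  \<comment> \<open>Of the two unit vectors parallel to \<open>T\<close>, the one along which \<open>\<sigma> * F\<close> decreases.\<close>
  define w where "w = (- \<sigma> * e / norm T) *\<^sub>R T"
  have w: "norm w = 1"
    using \<sigma> e \<open>T \<noteq> 0\<close> by (simp add: w_def abs_mult)
  have inB: "x0 + s *\<^sub>R w \<in> ?B" if "0 \<le> s" "s < \<delta>" for s
    using that w by (simp add: dist_norm)
  have slope: "\<sigma> * (gradient F x \<bullet> w) < - (\<bar>F x0\<bar> / \<delta>)" if "x \<in> ?B" for x
  proof -
    have "\<sigma> * (gradient F x \<bullet> w) = - (\<sigma> * \<sigma>) * (e * (gradient F x \<bullet> T)) / norm T"
      by (simp add: w_def)
    also have "\<dots> = - (\<bar>gradient F x \<bullet> T\<bar> / norm T)"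
      using \<sigma> e(2)[OF that] by simp
    also have "\<dots> < - (\<bar>F x0\<bar> / \<delta>)"
      using assms(4)[OF that] \<open>T \<noteq> 0\<close> \<open>\<delta> > 0\<close> by (simp add: field_simps)
    finally show ?thesis .
  qed
  have "\<exists>s. 0 < s \<and> s < \<delta> \<and> \<sigma> * F (x0 + s *\<^sub>R w) = 0"
  proof (rule zero_if_fast_decrease)
    fix s assume "0 \<le> s" "s < \<delta>"
    then have s: "x0 + s *\<^sub>R w \<in> ?B" by (rule inB)
    show "((\<lambda>s. \<sigma> * F (x0 + s *\<^sub>R w)) has_real_derivative
        \<sigma> * (gradient F (x0 + s *\<^sub>R w) \<bullet> w)) (at s)"
      by (intro DERIV_cmult DERIV_along_line diff s)
    show "\<sigma> * (gradient F (x0 + s *\<^sub>R w) \<bullet> w) < - (\<sigma> * F (x0 + 0 *\<^sub>R w) / \<delta>)"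
      using slope[OF s] \<sigma> by simp
  qed (use False \<sigma> \<open>\<delta> > 0\<close> in auto)
  then obtain s where "0 < s" "s < \<delta>" "F (x0 + s *\<^sub>R w) = 0"
    using \<sigma> by auto
  then show ?thesis
    using inB by (intro bexI[of _ "x0 + s *\<^sub>R w"]) auto
qed

end
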